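(* For $\sigma,\tau \in S_3$, say $\sigma$ and $\tau$ are ch-Wilf equivalent if $Ch_n(\{\sigma\};q)=Ch_n(\{\tau\};q)$ for all $n\ge 0$. Then the ch-Wilf equivalence classes of the six permutations of $S_3$ are exactly $\{123\}$, $\{321\}$, $\{312,132\}$ and $\{213,231\}$.
   Context: $S_n$ is the set of permutations of $[n]$ in one-line notation. A permutation $\pi$ avoids $\sigma$ if no subsequence of $\pi$ is order isomorphic to $\sigma$; for a set $\Pi$ of permutations, $Av_n(\Pi)$ is the set of permutations in $S_n$ avoiding every element of $\Pi$. For $\pi\in S_n$, the charge value of $i\in[n]$ is: $chv(1)=0$; for $i\ge2$, $chv(i)=0$ if $i$ is to the right of $i-1$ in $\pi$ and $chv(i)=n+1-i$ if $i$ is to the left of $i-1$ in $\pi$; the charge is $ch(\pi)=\sum_{i=1}^n chv(i)$. Define $Ch_n(\Pi;q)=\sum_{\sigma\in Av_n(\Pi)} q^{ch(\sigma)}$. *)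

theory Defs
  imports
    "HOL-Library.Sublist"
    "HOL-Combinatorics.Multiset_Permutations"
    "HOL-Computational_Algebra.Polynomial"
begin

text \<open>A permutation of \<open>{1..n}\<close> is represented by the list of its values (one-line notation).\<close>

definition S :: "nat \<Rightarrow> nat list set" where
  "S n = permutations_of_set {1..n}"

definition order_isomorphic :: "nat list \<Rightarrow> nat list \<Rightarrow> bool" where
  "order_isomorphic xs ys \<longleftrightarrow> length xs = length ys \<and>
     (\<forall>i<length xs. \<forall>j<length xs. xs ! i < xs ! j \<longleftrightarrow> ys ! i < ys ! j)"

definition avoids :: "nat list \<Rightarrow> nat list \<Rightarrow> bool" where
  "avoids \<pi> \<sigma> \<longleftrightarrow> \<not> (\<exists>xs. subseq xs \<pi> \<and> order_isomorphic xs \<sigma>)"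

definition Av :: "nat \<Rightarrow> nat list set \<Rightarrow> nat list set" where
  "Av n P = {\<pi> \<in> S n. \<forall>\<sigma>\<in>P. avoids \<pi> \<sigma>}"

definition left_of :: "nat list \<Rightarrow> nat \<Rightarrow> nat \<Rightarrow> bool" where
  "left_of \<pi> x y \<longleftrightarrow> (\<exists>a b. a < b \<and> b < length \<pi> \<and> \<pi> ! a = x \<and> \<pi> ! b = y)"

definition chv :: "nat list \<Rightarrow> nat \<Rightarrow> nat" where
  "chv \<pi> i = (if 2 \<le> i \<and> left_of \<pi> i (i - 1) then length \<pi> + 1 - i else 0)"

definition ch :: "nat list \<Rightarrow> nat" where
  "ch \<pi> = (\<Sum>i = 1..length \<pi>. chv \<pi> i)"

text \<open>The indeterminate of the polynomial plays the role of \<open>q\<close>.\<close>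

definition Ch :: "nat \<Rightarrow> nat list set \<Rightarrow> int poly" where
  "Ch n P = (\<Sum>\<sigma>\<in>Av n P. monom 1 (ch \<sigma>))"

definition ch_Wilf_equivalent :: "nat list \<Rightarrow> nat list \<Rightarrow> bool" where
  "ch_Wilf_equivalent \<sigma> \<tau> \<longleftrightarrow> (\<forall>n. Ch n {\<sigma>} = Ch n {\<tau>})"

end

theory Submission
  imports Defs
begin

text \<open>
  The charge of \<open>\<pi>\<close> is the sum of \<open>n - i\<close> over the inverse descents \<open>i\<close> of \<open>\<pi>\<close>, i.e. those \<open>i\<close> for
  which \<open>i + 1\<close> stands to the left of \<open>i\<close>. Split a permutation by its last entry \<open>k\<close>: if it avoids
  312, it is \<open>A B k\<close>, and if it avoids 132, it is \<open>B A k\<close>, where \<open>A\<close> consists of the entries smaller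
  than \<open>k\<close>, \<open>B\<close> of the larger ones, and both avoid the pattern. In either case the inverse descents
  are those of \<open>A\<close>, those of \<open>B\<close>, and \<open>k\<close> if \<open>B\<close> is nonempty, so by induction the inverse descent set
  has the same distribution over both classes. Reversal complements the inverse descent set, which
  gives the equivalence of 213 and 231. The remaining pairs are separated at \<open>n = 3\<close>, where only
  the pattern itself is missing from the sum.
\<close>

section \<open>Subsequences of length two and three\<close>

lemma subseq_set: "subseq xs ys \<Longrightarrow> x \<in> set xs \<Longrightarrow> x \<in> set ys"
  by (auto elim!: list_emb_set)

lemma subseq_pair_set: "subseq [x, y] xs \<Longrightarrow> x \<in> set xs \<and> y \<in> set xs"
  using subseq_set[of "[x, y]" xs] by simp

lemma subseq_pair_Cons: "subseq [x, y] (z # zs) \<longleftrightarrow> (x = z \<and> y \<in> set zs) \<or> subseq [x, y] zs"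
  by (auto simp: subseq_singleton_left intro: subseq_Cons' dest: subseq_pair_set)

lemma subseq_pair_append:
  "subseq [x, y] (xs @ ys) \<longleftrightarrow>
     subseq [x, y] xs \<or> x \<in> set xs \<and> y \<in> set ys \<or> subseq [x, y] ys"
  by (induction xs) (auto simp: subseq_pair_Cons simp del: subseq_Cons2_iff)

lemma subseq_triple_Cons:
  "subseq [x, y, z] (w # ws) \<longleftrightarrow> (x = w \<and> subseq [y, z] ws) \<or> subseq [x, y, z] ws"
  by (auto intro: subseq_Cons')

lemma subseq_triple_append:
  "subseq [x, y, z] (xs @ ys) \<longleftrightarrow>
     subseq [x, y, z] xs \<or> subseq [x, y] xs \<and> z \<in> set ys \<or>
     x \<in> set xs \<and> subseq [y, z] ys \<or> subseq [x, y, z] ys"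
  by (induction xs)
    (auto simp: subseq_pair_Cons subseq_triple_Cons subseq_pair_append simp del: subseq_Cons2_iff)

lemma subseq_pair_rev: "subseq [x, y] (rev xs) \<longleftrightarrow> subseq [y, x] xs"
  by (induction xs)
    (auto simp: subseq_pair_Cons subseq_pair_append simp del: subseq_Cons2_iff)

lemma subseq_pair_antisym:
  assumes "distinct xs" "subseq [x, y] xs"
  shows "\<not> subseq [y, x] xs"
  using assms
  by (induction xs) (auto simp: subseq_pair_Cons dest: subseq_pair_set simp del: subseq_Cons2_iff)

lemma subseq_pair_total:
  assumes "x \<in> set xs" "y \<in> set xs" "x \<noteq> y"
  shows "subseq [x, y] xs \<or> subseq [y, x] xs"
  using assms by (induction xs) (auto simp: subseq_pair_Cons simp del: subseq_Cons2_iff)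

text \<open>Once an entry fails \<open>P\<close>, the hypothesis makes every later entry fail it
  too, so the entries satisfying \<open>P\<close> form a prefix.\<close>

lemma partition_append:
  assumes "\<And>x y. subseq [x, y] xs \<Longrightarrow> P y \<Longrightarrow> P x"
  shows "filter P xs @ filter (\<lambda>x. \<not> P x) xs = xs"
  using assms
proof (induction xs)
  case (Cons a xs)
  have IH: "filter P xs @ filter (\<lambda>x. \<not> P x) xs = xs"
    using Cons.prems subseq_pair_Cons by (intro Cons.IH) blast
  show ?case
  proof (cases "P a")
    case False
    have "\<not> P x" if "x \<in> set xs" for x
      using Cons.prems[of a x] that False by (auto simp: subseq_singleton_left)
    then show ?thesis using False by (simp add: filter_empty_conv)
  qed (simp add: IH)
qed simp

lemma subseq_triple_snoc:
  "subseq [x, y, z] (xs @ [w]) \<longleftrightarrow> subseq [x, y, z] xs \<or> subseq [x, y] xs \<and> z = w"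
  by (auto simp: subseq_triple_append subseq_pair_Cons subseq_triple_Cons simp del: subseq_Cons2_iff)

section \<open>Inverse descents and the charge\<close>

lemma left_of_iff_subseq: "left_of xs x y \<longleftrightarrow> subseq [x, y] xs"
proof (induction xs)
  case (Cons z zs)
  have "left_of (z # zs) x y \<longleftrightarrow> (x = z \<and> y \<in> set zs) \<or> left_of zs x y"
  proof
    assume "left_of (z # zs) x y"
    then obtain a b where "a < b" "b < Suc (length zs)" "(z # zs) ! a = x" "(z # zs) ! b = y"
      by (auto simp: left_of_def)
    then obtain b' where b': "b = Suc b'" "b' < length zs" "zs ! b' = y"
      by (cases b) auto
    show "(x = z \<and> y \<in> set zs) \<or> left_of zs x y"
    proof (cases a)
      case 0
      then show ?thesis using b' \<open>(z # zs) ! a = x\<close> by auto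
    next
      case (Suc a')
      then show ?thesis
        using b' \<open>(z # zs) ! a = x\<close> \<open>a < b\<close> by (auto simp: left_of_def)
    qed
  next
    assume "(x = z \<and> y \<in> set zs) \<or> left_of zs x y"
    then show "left_of (z # zs) x y"
    proof
      assume "x = z \<and> y \<in> set zs"
      then obtain b where "b < length zs" "zs ! b = y" by (auto simp: in_set_conv_nth)
      then show ?thesis using \<open>x = z \<and> y \<in> set zs\<close>
        unfolding left_of_def by (intro exI[of _ 0] exI[of _ "Suc b"]) simp
    next
      assume "left_of zs x y"
      then obtain a b where "a < b" "b < length zs" "zs ! a = x" "zs ! b = y"
        by (auto simp: left_of_def)
      then show ?thesis
        unfolding left_of_def by (intro exI[of _ "Suc a"] exI[of _ "Suc b"]) auto
    qed
  qed
  then show ?case by (simp only: Cons.IH subseq_pair_Cons)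
qed (simp add: left_of_def)

text \<open>For a permutation these are the descents of its inverse. Each is recorded by the smaller
  value \<open>i\<close>, whereas \<open>chv\<close> charges the larger value
  \<open>Suc i\<close>.\<close>

definition inverse_descents :: "nat list \<Rightarrow> nat set" where
  "inverse_descents \<pi> = {i. subseq [Suc i, i] \<pi>}"

lemma length_S: "\<pi> \<in> S n \<Longrightarrow> length \<pi> = n"
  by (simp add: S_def length_finite_permutations_of_set)

lemma set_S: "\<pi> \<in> S n \<Longrightarrow> set \<pi> = {1..n}"
  by (simp add: S_def permutations_of_setD)

lemma distinct_S: "\<pi> \<in> S n \<Longrightarrow> distinct \<pi>"
  by (simp add: S_def permutations_of_setD)

lemma inverse_descents_subset: "\<pi> \<in> S n \<Longrightarrow> inverse_descents \<pi> \<subseteq> {1..<n}"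
  by (auto simp: inverse_descents_def set_S dest!: subseq_pair_set)

text \<open>An inverse descent \<open>i\<close> puts the charge \<open>n + 1 - Suc i = n - i\<close>
  on the value \<open>Suc i\<close>, and all other values have charge 0. So for fixed
  \<open>n\<close> the charge depends only on the inverse descent set.\<close>

lemma ch_eq_sum_inverse_descents:
  assumes "\<pi> \<in> S n"
  shows "ch \<pi> = (\<Sum>i\<in>inverse_descents \<pi>. n - i)"
proof -
  have "ch \<pi> = (\<Sum>i\<in>Suc ` inverse_descents \<pi>. chv \<pi> i)"
    unfolding ch_def
  proof (rule sum.mono_neutral_right)
    show "Suc ` inverse_descents \<pi> \<subseteq> {1..length \<pi>}"
      using inverse_descents_subset[OF assms] by (auto simp: length_S[OF assms])
    show "\<forall>i\<in>{1..length \<pi>} - Suc ` inverse_descents \<pi>. chv \<pi> i = 0"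
    proof
      fix i assume "i \<in> {1..length \<pi>} - Suc ` inverse_descents \<pi>"
      then show "chv \<pi> i = 0"
        by (cases i) (auto simp: chv_def left_of_iff_subseq inverse_descents_def)
    qed
  qed simp
  also have "\<dots> = (\<Sum>i\<in>inverse_descents \<pi>. chv \<pi> (Suc i))"
    by (simp add: sum.reindex)
  also have "\<dots> = (\<Sum>i\<in>inverse_descents \<pi>. n - i)"
    using inverse_descents_subset[OF assms]
    by (intro sum.cong)
      (auto simp: chv_def left_of_iff_subseq length_S[OF assms] inverse_descents_def)
  finally show ?thesis .
qed

text \<open>Reversal exchanges the two possible relative orders of \<open>i\<close> and
  \<open>Suc i\<close>, and in a permutation containing both values exactly one of them
  occurs.\<close>

lemma inverse_descents_rev:
  assumes "\<pi> \<in> S n"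
  shows "inverse_descents (rev \<pi>) = {1..<n} - inverse_descents \<pi>"
proof (rule set_eqI)
  fix i
  have bounds: "i \<in> {1..<n} \<longleftrightarrow> i \<in> set \<pi> \<and> Suc i \<in> set \<pi>"
    by (auto simp: set_S[OF assms])
  have "subseq [i, Suc i] \<pi> \<longleftrightarrow> i \<in> {1..<n} \<and> \<not> subseq [Suc i, i] \<pi>"
    unfolding bounds
    using subseq_pair_antisym[OF distinct_S[OF assms], of i "Suc i"]
      subseq_pair_set[of i "Suc i" \<pi>] subseq_pair_total[of i \<pi> "Suc i"] n_not_Suc_n[of i]
    by blast
  then show "i \<in> inverse_descents (rev \<pi>) \<longleftrightarrow> i \<in> {1..<n} - inverse_descents \<pi>"
    unfolding inverse_descents_def subseq_pair_rev by blast
qed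

section \<open>Reversal of lists and patterns\<close>

lemma order_isomorphic_rev:
  assumes "order_isomorphic xs ys"
  shows "order_isomorphic (rev xs) (rev ys)"
  using assms by (auto simp: order_isomorphic_def rev_nth)

lemma order_isomorphic_rev_iff:
  "order_isomorphic (rev xs) (rev ys) \<longleftrightarrow> order_isomorphic xs ys"
  using order_isomorphic_rev[of xs ys] order_isomorphic_rev[of "rev xs" "rev ys"] by auto

lemma subseq_rev: "subseq xs ys \<Longrightarrow> subseq (rev xs) (rev ys)"
proof (induction rule: list_emb.induct)
  case (list_emb_Cons2 x y xs ys)
  then show ?case by (simp add: list_emb_append_mono)
qed (simp_all add: subseq_rev_drop_many)

lemma subseq_rev_iff: "subseq (rev xs) (rev ys) \<longleftrightarrow> subseq xs ys"
  using subseq_rev[of xs ys] subseq_rev[of "rev xs" "rev ys"] by auto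

lemma avoids_rev: "avoids (rev \<pi>) \<sigma> \<longleftrightarrow> avoids \<pi> (rev \<sigma>)"
proof -
  have "subseq xs (rev \<pi>) \<and> order_isomorphic xs \<sigma> \<longleftrightarrow>
      subseq (rev xs) \<pi> \<and> order_isomorphic (rev xs) (rev \<sigma>)" for xs
    using subseq_rev_iff[of xs "rev \<pi>"] order_isomorphic_rev_iff[of xs \<sigma>] by simp
  then show ?thesis unfolding avoids_def by (metis rev_rev_ident)
qed

section \<open>The patterns 132 and 312 as inequalities\<close>

lemma order_isomorphic_triple:
  "order_isomorphic xs [x, y, z] \<longleftrightarrow> (\<exists>a b c. xs = [a, b, c] \<and>
     (a < b \<longleftrightarrow> x < y) \<and> (b < a \<longleftrightarrow> y < x) \<and> (a < c \<longleftrightarrow> x < z) \<and>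
     (c < a \<longleftrightarrow> z < x) \<and> (b < c \<longleftrightarrow> y < z) \<and> (c < b \<longleftrightarrow> z < y))"
proof (cases "length xs = 3")
  case True
  then obtain a b c where "xs = [a, b, c]"
    by (auto simp: numeral_3_eq_3 length_Suc_conv)
  then show ?thesis
    by (simp add: order_isomorphic_def numeral_3_eq_3 All_less_Suc2) blast
qed (auto simp: order_isomorphic_def)

lemma order_isomorphic_132:
  "order_isomorphic xs [1, 3, 2] \<longleftrightarrow> (\<exists>a b c. xs = [a, b, c] \<and> a < c \<and> c < b)"
  unfolding order_isomorphic_triple by force

lemma order_isomorphic_312:
  "order_isomorphic xs [3, 1, 2] \<longleftrightarrow> (\<exists>a b c. xs = [a, b, c] \<and> b < c \<and> c < a)"
  unfolding order_isomorphic_triple by force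

lemma avoids_132_iff:
  "avoids \<pi> [1, 3, 2] \<longleftrightarrow> (\<forall>a b c. subseq [a, b, c] \<pi> \<longrightarrow> \<not> (a < c \<and> c < b))"
  unfolding avoids_def order_isomorphic_132 by blast

lemma avoids_312_iff:
  "avoids \<pi> [3, 1, 2] \<longleftrightarrow> (\<forall>a b c. subseq [a, b, c] \<pi> \<longrightarrow> \<not> (b < c \<and> c < a))"
  unfolding avoids_def order_isomorphic_312 by blast

section \<open>Splitting avoiders at the last entry, and equidistribution\<close>

lemma avoids_subseq: "avoids \<pi> \<sigma> \<Longrightarrow> subseq \<rho> \<pi> \<Longrightarrow> avoids \<rho> \<sigma>"
  unfolding avoids_def using subseq_order.trans by blast

text \<open>Arbitrary intervals of values keep the recursion closed: the blocks below and above the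
  last entry are again permutations of intervals, with no renumbering.\<close>

definition interval_av :: "nat list \<Rightarrow> nat \<Rightarrow> nat \<Rightarrow> nat list set" where
  "interval_av \<sigma> m n = {\<pi> \<in> permutations_of_set {m..<n}. avoids \<pi> \<sigma>}"

lemma Av_singleton: "Av n {\<sigma>} = interval_av \<sigma> 1 (Suc n)"
  by (simp add: Av_def interval_av_def S_def atLeastLessThanSuc_atLeastAtMost)

lemma interval_avD:
  assumes "\<pi> \<in> interval_av \<sigma> m n"
  shows "set \<pi> = {m..<n}" "distinct \<pi>" "avoids \<pi> \<sigma>" "length \<pi> = n - m"
  using assms by (auto simp: interval_av_def permutations_of_setD length_finite_permutations_of_set)

lemma interval_avI:
  "set \<pi> = {m..<n} \<Longrightarrow> distinct \<pi> \<Longrightarrow> avoids \<pi> \<sigma> \<Longrightarrow> \<pi> \<in> interval_av \<sigma> m n"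
  by (simp add: interval_av_def permutations_of_set_def)

text \<open>What 132 and 312 have in common, so that the recursion is proved once.
  \<open>join\<close> fixes which of the low block \<open>A\<close> and the high block
  \<open>B\<close> comes first; \<open>avoids_join\<close> lets avoiding blocks be assembled, and
  \<open>join_filter\<close> makes every avoider arise in this way.\<close>

locale last_decomposition =
  fixes \<sigma> :: "nat list" and join :: "nat list \<Rightarrow> nat list \<Rightarrow> nat list"
  assumes join: "(\<forall>A B. join A B = A @ B) \<or> (\<forall>A B. join A B = B @ A)"
    and avoids_join: "\<And>A B k. \<lbrakk>\<forall>x\<in>set A. x < k; \<forall>x\<in>set B. k < x; avoids A \<sigma>; avoids B \<sigma>\<rbrakk>
      \<Longrightarrow> avoids (join A B @ [k]) \<sigma>"
    and join_filter: "\<And>xs k. avoids (xs @ [k]) \<sigma> \<Longrightarrow> k \<notin> set xs \<Longrightarrow>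
      join (filter (\<lambda>x. x < k) xs) (filter (\<lambda>x. k < x) xs) = xs"
begin

text \<open>The last entry recovers \<open>k\<close>, and \<open>k\<close> fixes the lengths of both
  blocks, so the concatenation splits in only one way; surjectivity comes from
  \<open>join_filter\<close>. For \<open>n \<le> m\<close> there is no \<open>k\<close> to choose
  although \<open>interval_av \<sigma> m n\<close> may contain \<open>[]\<close>, hence the case
  distinction in the target.\<close>

lemma bij_betw_join:
  "bij_betw (\<lambda>(k, A, B). join A B @ [k])
     (SIGMA k:{m..<n}. interval_av \<sigma> m k \<times> interval_av \<sigma> (Suc k) n)
     (if m < n then interval_av \<sigma> m n else {})"
proof (cases "m < n")
  case True
  have into: "join A B @ [k] \<in> interval_av \<sigma> m n"
    if "m \<le> k" "k < n" "A \<in> interval_av \<sigma> m k" "B \<in> interval_av \<sigma> (Suc k) n" for k A B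
  proof (rule interval_avI)
    note A = interval_avD[OF that(3)] and B = interval_avD[OF that(4)]
    show "set (join A B @ [k]) = {m..<n}" "distinct (join A B @ [k])"
      using join A B that(1,2) by auto
    show "avoids (join A B @ [k]) \<sigma>"
      using A B by (intro avoids_join) auto
  qed
  have onto: "\<exists>k A B. m \<le> k \<and> k < n \<and> A \<in> interval_av \<sigma> m k \<and>
      B \<in> interval_av \<sigma> (Suc k) n \<and> \<pi> = join A B @ [k]" if \<pi>: "\<pi> \<in> interval_av \<sigma> m n" for \<pi>
  proof -
    note p = interval_avD[OF \<pi>]
    have "\<pi> \<noteq> []" using p(4) True by auto
    then obtain xs k where xs: "\<pi> = xs @ [k]" by (metis rev_exhaust)
    have k: "m \<le> k" "k < n" "k \<notin> set xs" using p(1,2) xs by auto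
    have set_xs: "set xs = {m..<n} - {k}" using p(1,2) xs by auto
    have sub: "avoids (filter P xs) \<sigma>" for P
      using p(3) xs avoids_subseq subseq_filter_left subseq_rev_drop_many
      by (metis subseq_order.trans)
    have "filter (\<lambda>x. x < k) xs \<in> interval_av \<sigma> m k"
      using p(2) xs k set_xs sub by (intro interval_avI) auto
    moreover have "filter (\<lambda>x. k < x) xs \<in> interval_av \<sigma> (Suc k) n"
      using p(2) xs k set_xs sub by (intro interval_avI) auto
    ultimately show ?thesis
      using k join_filter[of xs k] p(3) xs by metis
  qed
  have inj: "A = A' \<and> B = B'"
    if "join A B = join A' B'" "A \<in> interval_av \<sigma> m k" "A' \<in> interval_av \<sigma> m k"
      "B \<in> interval_av \<sigma> (Suc k) n" "B' \<in> interval_av \<sigma> (Suc k) n" for k A A' B B'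
  proof -
    have "length A = length A'" "length B = length B'"
      using that(2-5)[THEN interval_avD(4)] by simp_all
    then show ?thesis using join that(1) by auto
  qed
  show ?thesis
  proof (rule bij_betw_imageI)
    show "inj_on (\<lambda>(k, A, B). join A B @ [k])
        (SIGMA k:{m..<n}. interval_av \<sigma> m k \<times> interval_av \<sigma> (Suc k) n)"
      by (rule inj_onI) (clarsimp, use inj in blast)
    show "(\<lambda>(k, A, B). join A B @ [k]) `
        (SIGMA k:{m..<n}. interval_av \<sigma> m k \<times> interval_av \<sigma> (Suc k) n) =
        (if m < n then interval_av \<sigma> m n else {})"
    proof (intro equalityI subsetI)
      fix \<pi> assume "\<pi> \<in> (if m < n then interval_av \<sigma> m n else {})"
      then have "\<pi> \<in> interval_av \<sigma> m n" using True by simp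
      then obtain k A B where "m \<le> k" "k < n" "A \<in> interval_av \<sigma> m k"
        "B \<in> interval_av \<sigma> (Suc k) n" "\<pi> = join A B @ [k]"
        using onto by blast
      then show "\<pi> \<in> (\<lambda>(k, A, B). join A B @ [k]) `
          (SIGMA k:{m..<n}. interval_av \<sigma> m k \<times> interval_av \<sigma> (Suc k) n)"
        by (intro image_eqI[of _ _ "(k, A, B)"]) auto
    qed (use into True in auto)
  qed
qed (simp add: bij_betw_def)

text \<open>The value \<open>k\<close> separates the values of \<open>A\<close> from those of
  \<open>B\<close>, so no two consecutive values straddle the blocks and their order does not
  matter. As \<open>k\<close> stands last, \<open>k - 1\<close> is never a new inverse descent,
  while \<open>k\<close> is one exactly when \<open>Suc k\<close> occurs in
  \<open>B\<close>.\<close>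

lemma inverse_descents_join:
  assumes "A \<in> interval_av \<sigma> m k" "B \<in> interval_av \<sigma> (Suc k) n"
  shows "inverse_descents (join A B @ [k]) =
    inverse_descents A \<union> inverse_descents B \<union> {i. i = k \<and> Suc k < n}"
  using join interval_avD(1)[OF assms(1)] interval_avD(1)[OF assms(2)]
  by (auto simp: inverse_descents_def subseq_pair_append subseq_singleton_left)

lemma sum_inverse_descents:
  fixes g :: "nat set \<Rightarrow> 'a::comm_monoid_add"
  assumes "m < n"
  shows "(\<Sum>\<pi>\<in>interval_av \<sigma> m n. g (inverse_descents \<pi>)) =
    (\<Sum>k\<in>{m..<n}. \<Sum>A\<in>interval_av \<sigma> m k. \<Sum>B\<in>interval_av \<sigma> (Suc k) n.
      g (inverse_descents A \<union> inverse_descents B \<union> {i. i = k \<and> Suc k < n}))"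
proof -
  have fin: "finite (interval_av \<sigma> a b)" for a b
    by (simp add: interval_av_def)
  have "(\<Sum>\<pi>\<in>interval_av \<sigma> m n. g (inverse_descents \<pi>)) =
    (\<Sum>(k, A, B)\<in>(SIGMA k:{m..<n}. interval_av \<sigma> m k \<times> interval_av \<sigma> (Suc k) n).
      g (inverse_descents (join A B @ [k])))"
    using sum.reindex_bij_betw[OF bij_betw_join[of m n], of "\<lambda>\<pi>. g (inverse_descents \<pi>)"] assms
    by (simp add: case_prod_unfold)
  also have "\<dots> = (\<Sum>(k, A, B)\<in>(SIGMA k:{m..<n}. interval_av \<sigma> m k \<times> interval_av \<sigma> (Suc k) n).
      g (inverse_descents A \<union> inverse_descents B \<union> {i. i = k \<and> Suc k < n}))"
    by (intro sum.cong) (auto simp: inverse_descents_join)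
  also have "\<dots> = (\<Sum>k\<in>{m..<n}. \<Sum>(A, B)\<in>interval_av \<sigma> m k \<times> interval_av \<sigma> (Suc k) n.
      g (inverse_descents A \<union> inverse_descents B \<union> {i. i = k \<and> Suc k < n}))"
    by (subst sum.Sigma) (auto simp: fin)
  also have "\<dots> = (\<Sum>k\<in>{m..<n}. \<Sum>A\<in>interval_av \<sigma> m k. \<Sum>B\<in>interval_av \<sigma> (Suc k) n.
      g (inverse_descents A \<union> inverse_descents B \<union> {i. i = k \<and> Suc k < n}))"
    by (simp add: sum.cartesian_product)
  finally show ?thesis .
qed

end

text \<open>The base of the recursion. The pattern must be nonempty because \<open>[]\<close>
  contains the empty pattern.\<close>

lemma interval_av_empty:
  assumes "n \<le> m" "\<sigma> \<noteq> []"
  shows "interval_av \<sigma> m n = {[]}"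
  using assms by (auto simp: interval_av_def avoids_def order_isomorphic_def)

text \<open>The arbitrary summand \<open>g\<close> expresses equality of distributions. Both classes
  satisfy the same recursion, so induction on the length of the interval applies; \<open>g\<close>
  has to be generalized since the contributions of \<open>k\<close> and of the other block are
  absorbed into it.\<close>

lemma inverse_descents_equidistributed:
  fixes g :: "nat set \<Rightarrow> 'a::comm_monoid_add"
  assumes "last_decomposition \<sigma> join" "last_decomposition \<tau> join'" "\<sigma> \<noteq> []" "\<tau> \<noteq> []"
  shows "(\<Sum>\<pi>\<in>interval_av \<sigma> m n. g (inverse_descents \<pi>)) =
         (\<Sum>\<pi>\<in>interval_av \<tau> m n. g (inverse_descents \<pi>))"
proof (induction "n - m" arbitrary: m n g rule: less_induct)
  case less
  show ?case
  proof (cases "m < n")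
    case True
    let ?D = "\<lambda>k A B. inverse_descents A \<union> inverse_descents B \<union> {i. i = k \<and> Suc k < n}"
    have "(\<Sum>A\<in>interval_av \<sigma> m k. \<Sum>B\<in>interval_av \<sigma> (Suc k) n. g (?D k A B)) =
      (\<Sum>A\<in>interval_av \<tau> m k. \<Sum>B\<in>interval_av \<tau> (Suc k) n. g (?D k A B))"
      if "k \<in> {m..<n}" for k
    proof -
      \<comment> \<open>First the high block is exchanged with \<open>A\<close> held fixed.\<close>
      have "(\<Sum>B\<in>interval_av \<sigma> (Suc k) n. g (?D k A B)) =
        (\<Sum>B\<in>interval_av \<tau> (Suc k) n. g (?D k A B))" for A
        using that less[of n "Suc k" "\<lambda>D. g (inverse_descents A \<union> D \<union> {i. i = k \<and> Suc k < n})"]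
        by auto
      \<comment> \<open>Then the low block: the whole inner sum, already taken over
        \<open>\<tau>\<close>, is a function of the inverse descents of \<open>A\<close>
        alone.\<close>
      then show ?thesis
        using that less[of k m "\<lambda>D. \<Sum>B\<in>interval_av \<tau> (Suc k) n.
            g (D \<union> inverse_descents B \<union> {i. i = k \<and> Suc k < n})"]
        by auto
    qed
    then show ?thesis
      by (simp add: last_decomposition.sum_inverse_descents[OF assms(1) True]
          last_decomposition.sum_inverse_descents[OF assms(2) True])
  next
    case False
    then show ?thesis using assms(3,4) by (simp add: interval_av_empty)
  qed
qed

section \<open>The last-entry decompositions for 312 and 132\<close>

lemma last_decomposition_312: "last_decomposition [3, 1, 2] (\<lambda>A B. A @ B)"
proof
  fix A B :: "nat list" and k
  assume "\<forall>x\<in>set A. x < k" "\<forall>x\<in>set B. k < x" "avoids A [3, 1, 2]" "avoids B [3, 1, 2]"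
  note AB = this
  show "avoids ((A @ B) @ [k]) [3, 1, 2]"
    unfolding avoids_312_iff
  proof (intro allI impI notI, elim conjE)
    fix a b c assume sub: "subseq [a, b, c] ((A @ B) @ [k])" and less: "b < c" "c < a"
    have A: "x < k" if "x \<in> set A" for x using AB(1) that by blast
    have B: "k < x" if "x \<in> set B" for x using AB(2) that by blast
    have "\<not> subseq [a, b, c] A" "\<not> subseq [a, b, c] B"
      using AB(3,4) less unfolding avoids_312_iff by blast+
    \<comment> \<open>The remaining occurrences straddle blocks. One ending in \<open>k\<close>
      needs an entry of \<open>B\<close> before an entry of \<open>A\<close>; one crossing from
      \<open>A\<close> to \<open>B\<close> has \<open>a < k < c\<close>, against
      \<open>c < a\<close>.\<close>
    then consider "subseq [a, b] (A @ B)" "c = k"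
      | "subseq [a, b] A" "c \<in> set B" | "a \<in> set A" "subseq [b, c] B"
      using sub[unfolded subseq_triple_snoc, unfolded subseq_triple_append] by argo
    then show False
    proof cases
      case 1
      then have "a \<in> set A \<and> b \<in> set B \<or> a \<in> set A \<and> b \<in> set A \<or> a \<in> set B \<and> b \<in> set B"
        unfolding subseq_pair_append using subseq_pair_set by metis
      then show False
        using less 1(2) by (auto dest!: A B)
    next
      case 2
      then show False
        using less subseq_pair_set[OF 2(1)] by (auto dest!: A B)
    next
      case 3
      then show False
        using less subseq_pair_set[OF 3(2)] by (auto dest!: A B)
    qed
  qed
next
  fix xs :: "nat list" and k
  assume av: "avoids (xs @ [k]) [3, 1, 2]" and k: "k \<notin> set xs"
  \<comment> \<open>An entry above \<open>k\<close> standing before one below \<open>k\<close> would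
    form 312 with the final \<open>k\<close>; so the low entries come first.\<close>
  have "x < k" if "subseq [x, y] xs" "y < k" for x y
    using av that k subseq_pair_set[OF that(1)] linorder_neqE_nat[of x k]
    unfolding avoids_312_iff subseq_triple_snoc by blast
  from partition_append[of xs "\<lambda>x. x < k", OF this]
  have "filter (\<lambda>x. x < k) xs @ filter (\<lambda>x. \<not> x < k) xs = xs" .
  moreover have "filter (\<lambda>x. \<not> x < k) xs = filter (\<lambda>x. k < x) xs"
    using k by (intro filter_cong) (auto simp: not_less order.order_iff_strict)
  ultimately show "filter (\<lambda>x. x < k) xs @ filter (\<lambda>x. k < x) xs = xs" by simp
qed simp

lemma last_decomposition_132: "last_decomposition [1, 3, 2] (\<lambda>A B. B @ A)"
proof
  fix A B :: "nat list" and k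
  assume "\<forall>x\<in>set A. x < k" "\<forall>x\<in>set B. k < x" "avoids A [1, 3, 2]" "avoids B [1, 3, 2]"
  note AB = this
  show "avoids ((B @ A) @ [k]) [1, 3, 2]"
    unfolding avoids_132_iff
  proof (intro allI impI notI, elim conjE)
    fix a b c assume sub: "subseq [a, b, c] ((B @ A) @ [k])" and less: "a < c" "c < b"
    have A: "x < k" if "x \<in> set A" for x using AB(1) that by blast
    have B: "k < x" if "x \<in> set B" for x using AB(2) that by blast
    have "\<not> subseq [a, b, c] A" "\<not> subseq [a, b, c] B"
      using AB(3,4) less unfolding avoids_132_iff by blast+
    \<comment> \<open>Here an occurrence ending in \<open>k\<close> needs an entry of
      \<open>A\<close> before an entry of \<open>B\<close>, and one crossing from \<open>B\<close>
      to \<open>A\<close> has \<open>c < k < a\<close>, against \<open>a < c\<close>.\<close>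
    then consider "subseq [a, b] (B @ A)" "c = k"
      | "subseq [a, b] B" "c \<in> set A" | "a \<in> set B" "subseq [b, c] A"
      using sub[unfolded subseq_triple_snoc, unfolded subseq_triple_append] by argo
    then show False
    proof cases
      case 1
      then have "a \<in> set B \<and> b \<in> set A \<or> a \<in> set A \<and> b \<in> set A \<or> a \<in> set B \<and> b \<in> set B"
        unfolding subseq_pair_append using subseq_pair_set by metis
      then show False
        using less 1(2) by (auto dest!: A B)
    next
      case 2
      then show False
        using less subseq_pair_set[OF 2(1)] by (auto dest!: A B)
    next
      case 3
      then show False
        using less subseq_pair_set[OF 3(2)] by (auto dest!: A B)
    qed
  qed
next
  fix xs :: "nat list" and k
  assume av: "avoids (xs @ [k]) [1, 3, 2]" and k: "k \<notin> set xs"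
  \<comment> \<open>An entry below \<open>k\<close> standing before one above \<open>k\<close> would
    form 132 with the final \<open>k\<close>; so the high entries come first.\<close>
  have "k < x" if "subseq [x, y] xs" "k < y" for x y
    using av that k subseq_pair_set[OF that(1)] linorder_neqE_nat[of x k]
    unfolding avoids_132_iff subseq_triple_snoc by blast
  from partition_append[of xs "\<lambda>x. k < x", OF this]
  have "filter (\<lambda>x. k < x) xs @ filter (\<lambda>x. \<not> k < x) xs = xs" .
  moreover have "filter (\<lambda>x. \<not> k < x) xs = filter (\<lambda>x. x < k) xs"
    using k by (intro filter_cong) (auto simp: not_less order.order_iff_strict)
  ultimately show "filter (\<lambda>x. k < x) xs @ filter (\<lambda>x. x < k) xs = xs" by simp
qed simp

section \<open>The equivalences of 132 with 312 and of 231 with 213\<close>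

lemma inverse_descents_132_312:
  fixes g :: "nat set \<Rightarrow> 'a::comm_monoid_add"
  shows "(\<Sum>\<pi>\<in>Av n {[1, 3, 2]}. g (inverse_descents \<pi>)) =
         (\<Sum>\<pi>\<in>Av n {[3, 1, 2]}. g (inverse_descents \<pi>))"
  unfolding Av_singleton
  by (rule inverse_descents_equidistributed[OF last_decomposition_132 last_decomposition_312])
    simp_all

lemma Ch_eq_sum_inverse_descents:
  "Ch n P = (\<Sum>\<pi>\<in>Av n P. monom 1 (\<Sum>i\<in>inverse_descents \<pi>. n - i))"
  unfolding Ch_def by (intro sum.cong) (auto simp: Av_def ch_eq_sum_inverse_descents)

text \<open>Reversal maps the avoiders of one pattern bijectively to those of the other. The result
  is again a sum of a function of inverse descent sets over the original class, the form to which
  equidistribution applies.\<close>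

lemma Ch_rev:
  "Ch n {rev \<sigma>} = (\<Sum>\<pi>\<in>Av n {\<sigma>}. monom 1 (\<Sum>i\<in>{1..<n} - inverse_descents \<pi>. n - i))"
proof -
  have "bij_betw rev (Av n {\<sigma>}) (Av n {rev \<sigma>})"
    by (rule bij_betwI[of _ _ _ rev])
      (auto simp: Av_def S_def permutations_of_set_def avoids_rev)
  then have "Ch n {rev \<sigma>} =
      (\<Sum>\<pi>\<in>Av n {\<sigma>}. monom 1 (\<Sum>i\<in>inverse_descents (rev \<pi>). n - i))"
    unfolding Ch_eq_sum_inverse_descents by (rule sum.reindex_bij_betw[symmetric])
  also have "\<dots> = (\<Sum>\<pi>\<in>Av n {\<sigma>}. monom 1 (\<Sum>i\<in>{1..<n} - inverse_descents \<pi>. n - i))"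
    by (intro sum.cong) (auto simp: Av_def inverse_descents_rev)
  finally show ?thesis .
qed

lemma ch_Wilf_132_312: "ch_Wilf_equivalent [1, 3, 2] [3, 1, 2]"
  unfolding ch_Wilf_equivalent_def Ch_eq_sum_inverse_descents
  using inverse_descents_132_312[where g = "\<lambda>D. monom 1 (\<Sum>i\<in>D. _ - i)"] by blast

lemma ch_Wilf_231_213: "ch_Wilf_equivalent [2, 3, 1] [2, 1, 3]"
proof -
  \<comment> \<open>The patterns 231 and 213 are the reversals of 132 and 312; complementing the
    inverse descent set is just another choice of \<open>g\<close>.\<close>
  have "Ch n {rev [1, 3, 2]} = Ch n {rev [3, 1, 2]}" for n
    unfolding Ch_rev by (rule inverse_descents_132_312)
  then show ?thesis by (simp add: ch_Wilf_equivalent_def)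
qed

section \<open>The case \<open>n = 3\<close> and the classification\<close>

lemma S_3: "S 3 = {[1, 2, 3], [1, 3, 2], [2, 1, 3], [2, 3, 1], [3, 1, 2], [3, 2, 1]}"
proof -
  have "{1..3::nat} = set [1, 2, 3]" by auto
  then show ?thesis
    by (simp only: S_def permutations_of_list)
      (simp add: permutations_of_set_list_def permutations_of_set_aux_list.simps List.bind_def
          insert_commute)
qed

lemma ch_triple: "ch [x, y, z] = chv [x, y, z] 2 + chv [x, y, z] 3"
proof -
  have "{1..length [x, y, z]} = {1, 2, 3}" by auto
  then show ?thesis unfolding ch_def by (simp add: chv_def)
qed

text \<open>The charges 1 and 2 are each taken by one of the two equivalent pairs, while 0 and 3
  single out 123 and 321.\<close>

lemma ch_S_3:
  "ch [1, 2, 3] = 0" "ch [1, 3, 2] = 1" "ch [2, 1, 3] = 2"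
  "ch [2, 3, 1] = 2" "ch [3, 1, 2] = 1" "ch [3, 2, 1] = 3"
  by (simp_all add: ch_triple chv_def left_of_iff_subseq subseq_pair_Cons del: subseq_Cons2_iff)

lemma order_isomorphic_S_3:
  assumes "\<sigma> \<in> S 3" "\<tau> \<in> S 3"
  shows "order_isomorphic \<sigma> \<tau> \<longleftrightarrow> \<sigma> = \<tau>"
  using assms unfolding S_3 by (elim insertE) (simp_all add: order_isomorphic_triple)

text \<open>A subsequence of full length is the whole list, and distinct elements of
  \<open>S 3\<close> are not order isomorphic, so \<open>\<sigma>\<close> is the only permutation
  excluded.\<close>

lemma Ch_3_eq:
  assumes "\<sigma> \<in> S 3"
  shows "Ch 3 {\<sigma>} = (\<Sum>\<pi>\<in>S 3. monom 1 (ch \<pi>)) - monom 1 (ch \<sigma>)"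
proof -
  have "avoids \<pi> \<sigma> \<longleftrightarrow> \<pi> \<noteq> \<sigma>" if "\<pi> \<in> S 3" for \<pi>
  proof -
    have "length xs = length \<pi>" if "order_isomorphic xs \<sigma>" for xs
      using that \<open>\<pi> \<in> S 3\<close> assms by (simp add: order_isomorphic_def length_S)
    then have "(\<exists>xs. subseq xs \<pi> \<and> order_isomorphic xs \<sigma>) \<longleftrightarrow> order_isomorphic \<pi> \<sigma>"
      by (metis subseq_order.order_refl subseq_same_length)
    then show ?thesis
      unfolding avoids_def order_isomorphic_S_3[OF \<open>\<pi> \<in> S 3\<close> assms] by simp
  qed
  then have "Av 3 {\<sigma>} = S 3 - {\<sigma>}" by (auto simp: Av_def)
  then show ?thesis
    using assms by (simp add: Ch_def sum_diff1 S_def)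
qed

text \<open>At \<open>n = 3\<close> the missing monomial reveals the charge of the pattern.
  Conversely, the table of charges leaves only the two pairs already proved equivalent, besides
  equal patterns.\<close>

lemma ch_Wilf_equivalent_iff:
  assumes "\<sigma> \<in> S 3" "\<tau> \<in> S 3"
  shows "ch_Wilf_equivalent \<sigma> \<tau> \<longleftrightarrow> ch \<sigma> = ch \<tau>"
proof
  assume "ch_Wilf_equivalent \<sigma> \<tau>"
  then have "Ch 3 {\<sigma>} = Ch 3 {\<tau>}" by (simp add: ch_Wilf_equivalent_def)
  then have "monom (1 :: int) (ch \<sigma>) = monom 1 (ch \<tau>)"
    using assms by (simp add: Ch_3_eq)
  then show "ch \<sigma> = ch \<tau>" by (simp add: monom_eq_iff')
next
  assume "ch \<sigma> = ch \<tau>"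
  then show "ch_Wilf_equivalent \<sigma> \<tau>"
    using assms ch_Wilf_132_312 ch_Wilf_231_213
    by (auto simp: S_3 ch_S_3 ch_Wilf_equivalent_def simp del: One_nat_def)
qed

theorem theorem1:
  shows "S 3 // {(\<sigma>, \<tau>). \<sigma> \<in> S 3 \<and> \<tau> \<in> S 3 \<and> ch_Wilf_equivalent \<sigma> \<tau>} =
    {{[1, 2, 3]}, {[3, 2, 1]}, {[3, 1, 2], [1, 3, 2]}, {[2, 1, 3], [2, 3, 1]}}"
proof -
  have Collect_insert: "{x \<in> insert a A. P x} =
      (if P a then insert a {x \<in> A. P x} else {x \<in> A. P x})"
    for a :: "nat list" and A P
    by auto
  \<comment> \<open>Equivalence on \<open>S 3\<close> is equality of charges, so the classes are the
    fibres of \<open>ch\<close>.\<close>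
  have "S 3 // {(\<sigma>, \<tau>). \<sigma> \<in> S 3 \<and> \<tau> \<in> S 3 \<and> ch_Wilf_equivalent \<sigma> \<tau>} =
      (\<lambda>\<sigma>. {\<tau> \<in> S 3. ch \<tau> = ch \<sigma>}) ` S 3"
    unfolding quotient_def UNION_singleton_eq_range
    by (intro image_cong) (auto simp: ch_Wilf_equivalent_iff)
  also have "\<dots> = {{[1, 2, 3]}, {[3, 2, 1]}, {[3, 1, 2], [1, 3, 2]}, {[2, 1, 3], [2, 3, 1]}}"
    unfolding S_3 Collect_insert image_insert ch_S_3 by (simp add: insert_commute)
  finally show ?thesis .
qed

end
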